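(* Let $J_T$ be an arbitrary period-$T$ Jacobi operator and let $\lambda\in\sigma_{ell}(J_T)$ with $\theta(\lambda)\neq\frac{\pi}{2}$. Then there exist a real sequence (potential) $(q_n)_{n\geq 1}$ with $q_n=O\left(\frac1n\right)$ and $q_n\neq o\left(\frac1n\right)$, and a non-zero vector $(u_n)_{n\geq 1}\in l^2(\mathbb{N};\mathbb{R})$, such that $$(J_T+Q)(u_n)_{n\geq 1}=\lambda (u_n)_{n\geq 1},$$ where $Q$ is the infinite diagonal matrix with entries $(q_n)$.
   Context: A period-$T$ Jacobi operator $J_T$ ($T\in\mathbb{N}$) is the operator on $l^2(\mathbb{N})$ given by the tridiagonal symmetric matrix with diagonal entries $b_1,b_2,\dots$ and off-diagonal entries $a_1,a_2,\dots$, where $(a_n)$ and $(b_n)$ are $T$-periodic, $a_n,b_n\in\mathbb{R}$ and $a_n>0$; that is, $(J_Tu)_1=b_1u_1+a_1u_2$ and $(J_Tu)_n=a_{n-1}u_{n-1}+b_nu_n+a_nu_{n+1}$ for $n\ge 2$. The transfer matrices are $$B_i(\lambda)=\begin{pmatrix}0&1\\-\frac{a_{i-1}}{a_i}&\frac{\lambda-b_i}{a_i}\end{pmatrix},\quad i\in\{1,\dots,T\},\ a_0:=a_T,$$ and the monodromy matrix is $M(\lambda)=B_T(\lambda)\cdots B_1(\lambda)$. The generalised interior of the essential spectrum is $\sigma_{ell}(J_T)=\{\lambda\in\mathbb{R} : |\operatorname{Tr}M(\lambda)|<2\}$. For $\lambda\in\sigma_{ell}(J_T)$ the eigenvalues of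 $M(\lambda)$ are $e^{\pm i\theta(\lambda)}$ with $\theta(\lambda)\in(0,\pi)$; $\theta(\lambda)$ is called the quasi-momentum. *)

theory Defs
  imports "HOL-Analysis.Analysis" "HOL-Library.Landau_Symbols"
begin

text \<open>
  Sequences indexed by \<open>1, 2, 3, \<dots>\<close> are functions on \<^typ>\<open>nat\<close>. The values at index \<open>0\<close> of the
  coefficients \<open>a\<close>, \<open>b\<close> and of a potential are irrelevant, while vectors of
  \<open>l\<^sup>2\<close> are extended by the value \<open>0\<close> at index \<open>0\<close>, so that equality of vectors is equality of
  functions.
\<close>

definition periodic_jacobi :: "nat \<Rightarrow> (nat \<Rightarrow> real) \<Rightarrow> (nat \<Rightarrow> real) \<Rightarrow> bool" where
  "periodic_jacobi T a b \<longleftrightarrow>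
     T \<ge> 1 \<and> (\<forall>n\<ge>1. a n > 0 \<and> a (n + T) = a n \<and> b (n + T) = b n)"

definition ell2 :: "(nat \<Rightarrow> real) set" where
  "ell2 = {u. u 0 = 0 \<and> summable (\<lambda>n. (u n)\<^sup>2)}"

definition jacobi_op :: "(nat \<Rightarrow> real) \<Rightarrow> (nat \<Rightarrow> real) \<Rightarrow> (nat \<Rightarrow> real) \<Rightarrow> nat \<Rightarrow> real" where
  "jacobi_op a b u n =
     (if n = 0 then 0
      else if n = 1 then b 1 * u 1 + a 1 * u 2
      else a (n - 1) * u (n - 1) + b n * u n + a n * u (n + 1))"

definition diagonal_op :: "(nat \<Rightarrow> real) \<Rightarrow> (nat \<Rightarrow> real) \<Rightarrow> nat \<Rightarrow> real" where
  "diagonal_op q u n = q n * u n"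

text \<open>The convention \<open>a\<^sub>0 = a\<^sub>T\<close> of the transfer matrices is built in, since \<open>a 0\<close> is arbitrary.\<close>

definition transfer_matrix ::
  "nat \<Rightarrow> (nat \<Rightarrow> real) \<Rightarrow> (nat \<Rightarrow> real) \<Rightarrow> real \<Rightarrow> nat \<Rightarrow> real^2^2" where
  "transfer_matrix T a b lam i =
     vector [vector [0, 1],
             vector [- (if i = 1 then a T else a (i - 1)) / a i, (lam - b i) / a i]]"

primrec transfer_product ::
  "nat \<Rightarrow> (nat \<Rightarrow> real) \<Rightarrow> (nat \<Rightarrow> real) \<Rightarrow> real \<Rightarrow> nat \<Rightarrow> real^2^2" where
  "transfer_product T a b lam 0 = mat 1"
| "transfer_product T a b lam (Suc k) =
     transfer_matrix T a b lam (Suc k) ** transfer_product T a b lam k"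

definition monodromy :: "nat \<Rightarrow> (nat \<Rightarrow> real) \<Rightarrow> (nat \<Rightarrow> real) \<Rightarrow> real \<Rightarrow> real^2^2" where
  "monodromy T a b lam = transfer_product T a b lam T"

definition sigma_ell :: "nat \<Rightarrow> (nat \<Rightarrow> real) \<Rightarrow> (nat \<Rightarrow> real) \<Rightarrow> real set" where
  "sigma_ell T a b = {lam. \<bar>trace (monodromy T a b lam)\<bar> < 2}"

definition complex_eigenvalues :: "real^'n^'n \<Rightarrow> complex set" where
  "complex_eigenvalues A =
     {z. \<exists>v. v \<noteq> 0 \<and> map_matrix complex_of_real A *v v = z *s v}"

text \<open>
  For periodic Jacobi coefficients this description determines \<open>\<theta>(\<lambda>)\<close> uniquely on
  \<^term>\<open>sigma_ell T a b\<close>; see \<open>quasi_momentum_unique\<close> below. Outside that set it is unspecified.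
\<close>

definition quasi_momentum :: "nat \<Rightarrow> (nat \<Rightarrow> real) \<Rightarrow> (nat \<Rightarrow> real) \<Rightarrow> real \<Rightarrow> real" where
  "quasi_momentum T a b lam =
     (THE \<theta>. 0 < \<theta> \<and> \<theta> < pi \<and>
        complex_eigenvalues (monodromy T a b lam) = {cis \<theta>, cis (- \<theta>)})"


lemma complex_eigenvalues_2:
  fixes A :: "real^2^2"
  shows "complex_eigenvalues A =
    {z. z\<^sup>2 - complex_of_real (trace A) * z + complex_of_real (det A) = 0}"
proof -
  have "z \<in> complex_eigenvalues A \<longleftrightarrow>
      z\<^sup>2 - complex_of_real (trace A) * z + complex_of_real (det A) = 0" for z
  proof -
    let ?C = "map_matrix complex_of_real A"
    have "z \<in> complex_eigenvalues A \<longleftrightarrow> (\<exists>v. v \<noteq> 0 \<and> (?C - mat z) *v v = 0)"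
    proof -
      have "mat z *v v = z *s v" for v :: "complex^2"
        by (simp add: vec_eq_iff matrix_vector_mult_def mat_def sum_2 forall_2)
      then show ?thesis
        by (simp add: complex_eigenvalues_def matrix_vector_mult_diff_rdistrib)
    qed
    also have "\<dots> \<longleftrightarrow> \<not> invertible (?C - mat z)"
      unfolding invertible_left_inverse matrix_left_invertible_ker by blast
    also have "\<dots> \<longleftrightarrow> det (?C - mat z) = 0"
      by (simp add: invertible_det_nz)
    also have "det (?C - mat z) = z\<^sup>2 - complex_of_real (trace A) * z + complex_of_real (det A)"
      by (simp add: det_2 trace_def sum_2 mat_def map_matrix_def power2_eq_square algebra_simps)
    finally show ?thesis .
  qed
  then show ?thesis by blast
qed

lemma det_transfer_product:
  assumes J: "periodic_jacobi T a b"
  shows "det (transfer_product T a b lam k) = (if k = 0 then 1 else a T / a k)"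
proof (induction k)
  case (Suc k)
  have pos: "a (Suc j) > 0" for j using J by (simp add: periodic_jacobi_def)
  have "det (transfer_matrix T a b lam (Suc k)) = (if k = 0 then a T else a k) / a (Suc k)"
    by (simp add: transfer_matrix_def det_2)
  moreover have "k \<noteq> 0 \<Longrightarrow> a k \<noteq> 0" using pos[of "k - 1"] by simp
  ultimately show ?case using Suc by (simp add: det_mul)
qed simp

lemma det_monodromy:
  assumes J: "periodic_jacobi T a b"
  shows "det (monodromy T a b lam) = 1"
proof -
  have "T \<ge> 1" "a T > 0" using J by (auto simp: periodic_jacobi_def)
  then show ?thesis by (simp add: monodromy_def det_transfer_product[OF J])
qed

lemma quasi_momentum_unique:
  assumes J: "periodic_jacobi T a b" and l: "lam \<in> sigma_ell T a b"
  shows "\<exists>!\<theta>. 0 < \<theta> \<and> \<theta> < pi \<and>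
           complex_eigenvalues (monodromy T a b lam) = {cis \<theta>, cis (- \<theta>)}"
proof -
  define t where "t = trace (monodromy T a b lam)"
  have t: "\<bar>t\<bar> < 2" using l by (simp add: sigma_ell_def t_def)
  have roots: "{z. z\<^sup>2 - complex_of_real (2 * cos \<theta>) * z + 1 = 0} = {cis \<theta>, cis (- \<theta>)}" for \<theta>
  proof -
    have "z\<^sup>2 - complex_of_real (2 * cos \<theta>) * z + 1 = (z - cis \<theta>) * (z - cis (- \<theta>))" for z
    proof -
      have "cis \<theta> + cis (- \<theta>) = complex_of_real (2 * cos \<theta>)"
        by (simp add: complex_eq_iff)
      moreover have "cis \<theta> * cis (- \<theta>) = 1" by (simp add: cis_mult)
      moreover have "(w - p) * (w - r) = w\<^sup>2 - (p + r) * w + p * r" for p r w :: complex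
        by (simp add: power2_eq_square algebra_simps)
      ultimately show ?thesis by metis
    qed
    then show ?thesis by auto
  qed
  have E: "complex_eigenvalues (monodromy T a b lam) = {z. z\<^sup>2 - complex_of_real t * z + 1 = 0}"
    by (simp add: complex_eigenvalues_2 det_monodromy[OF J] t_def)
  show ?thesis
  proof (rule ex1I[of _ "arccos (t / 2)"])
    have "0 < arccos (t / 2)" "arccos (t / 2) < pi" "2 * cos (arccos (t / 2)) = t"
      using arccos_lt_bounded[of "t / 2"] cos_arccos[of "t / 2"] t by auto
    then show "0 < arccos (t / 2) \<and> arccos (t / 2) < pi \<and>
        complex_eigenvalues (monodromy T a b lam) = {cis (arccos (t / 2)), cis (- arccos (t / 2))}"
      using roots[of "arccos (t / 2)"] E by simp
  next
    fix \<theta> assume *: "0 < \<theta> \<and> \<theta> < pi \<and>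
        complex_eigenvalues (monodromy T a b lam) = {cis \<theta>, cis (- \<theta>)}"
    then have z: "(cis \<theta>)\<^sup>2 - complex_of_real t * cis \<theta> + 1 = 0"
      using E by auto
    have "(cis \<theta>)\<^sup>2 - complex_of_real (2 * cos \<theta>) * cis \<theta> + 1 = 0"
      using roots[of \<theta>] by blast
    with z have "complex_of_real t * cis \<theta> = complex_of_real (2 * cos \<theta>) * cis \<theta>"
      by algebra
    then have "t = 2 * cos \<theta>"
      by (metis cis_neq_zero mult_right_cancel of_real_eq_iff)
    then show "\<theta> = arccos (t / 2)"
      using * by (simp add: arccos_cos)
  qed
qed

end

theory Submission
  imports Defs
begin

text \<open>
  The potential is built by feedback. It is supported on the multiples of the period, so between two
  of its sites the solution evolves freely, and the pair \<open>(u\<^sub>k\<^sub>T, u\<^sub>k\<^sub>T\<^sub>+\<^sub>1)\<close> is first multiplied by the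
  monodromy matrix and then sheared by the value of the potential at the site reached.

  In the elliptic case the monodromy matrix is conjugate to a rotation by the quasi-momentum \<open>\<theta>\<close>, and
  the conjugation (\<open>elliptic_matrix_rotation\<close>) can be chosen so that the shear stays a shear
  \<open>(X, Z) \<mapsto> (X, Z + e X)\<close> along a coordinate axis. It changes the conserved energy \<open>X\<^sup>2 + Z\<^sup>2\<close> by
  \<open>2 e X Z + e\<^sup>2 X\<^sup>2\<close>. The values \<open>X\<close> and \<open>Z\<close> are
  determined by the solution before the kick, so the sign of \<open>e\<close> may be chosen opposite to that of
  \<open>X Z\<close>; then the first-order term never increases the energy.

  The gain is small only if \<open>(X, Z)\<close> lies near a coordinate axis. Two consecutive points cannot both
  do so if the kicks are small: the angle between them is \<open>\<theta>\<close> up to \<open>O(e)\<close>, while the axes are \<open>\<pi> / 2\<close> apart and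
  \<open>\<theta> \<in> (0, \<pi>)\<close> differs from \<open>\<pi> / 2\<close>. Quantitatively (\<open>two_kicks_contract\<close>), two kicks of small size
  \<open>h\<close> multiply the energy by at most \<open>1 - \<delta> h\<close>, where \<open>\<delta> = \<bar>cos \<theta> sin \<theta>\<bar> / 2 > 0\<close>. With
  \<open>h = 2 / (\<delta> m)\<close> in the pair of kicks number \<open>m\<close> the factors \<open>1 - 2 / m\<close> force the energy to decay
  like \<open>1 / m\<^sup>2\<close> (\<open>kicked_rotation_decay\<close>). Inside a period the square of the solution is
  at most a constant times the energy at its start, so the solution is square summable. At its sites
  the potential has size a constant over \<open>m\<close>, and \<open>m\<close> grows linearly along them.
\<close>

section \<open>Kicked rotations\<close>

text \<open>
  One step: the rotation carries \<open>(X, Y)\<close> to \<open>(X', Z')\<close> without changing the energy, and the kick \<open>e\<close>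
  acts against the sign of \<open>X' Z'\<close>. The second bound limits how much energy a step can remove; it lets
  a gain measured between two steps be compared with the energy before both.
\<close>

lemma kicked_energy:
  fixes c s :: real
  assumes cs: "c\<^sup>2 + s\<^sup>2 = 1"
    and X: "X' = c * X - s * Y" and Z: "Z' = s * X + c * Y" and Y: "Y' = Z' + e * X'"
    and e: "\<bar>e\<bar> = h" and sgn: "e * (X' * Z') \<le> 0"
  shows "X'\<^sup>2 + Y'\<^sup>2 \<le> (X\<^sup>2 + Y\<^sup>2) - 2 * h * \<bar>X' * Z'\<bar> + h\<^sup>2 * (X\<^sup>2 + Y\<^sup>2)"
    and "(1 - h) * (X\<^sup>2 + Y\<^sup>2) \<le> X'\<^sup>2 + Y'\<^sup>2"
proof -
  have rot: "X'\<^sup>2 + Z'\<^sup>2 = X\<^sup>2 + Y\<^sup>2"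
  proof -
    have "X'\<^sup>2 + Z'\<^sup>2 = (c\<^sup>2 + s\<^sup>2) * (X\<^sup>2 + Y\<^sup>2)"
      unfolding X Z by (simp add: power2_eq_square algebra_simps)
    then show ?thesis using cs by simp
  qed
  have "\<bar>e * (X' * Z')\<bar> = h * \<bar>X' * Z'\<bar>" using e by (simp add: abs_mult)
  then have eXZ: "e * (X' * Z') = - (h * \<bar>X' * Z'\<bar>)" using sgn by linarith
  have e2: "e\<^sup>2 = h\<^sup>2" using e by (metis power2_abs)
  have "X'\<^sup>2 + Y'\<^sup>2 = (X'\<^sup>2 + Z'\<^sup>2) + 2 * (e * (X' * Z')) + e\<^sup>2 * X'\<^sup>2"
    unfolding Y by (simp add: power2_eq_square algebra_simps)
  then have E: "X'\<^sup>2 + Y'\<^sup>2 = (X\<^sup>2 + Y\<^sup>2) - 2 * h * \<bar>X' * Z'\<bar> + h\<^sup>2 * X'\<^sup>2"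
    unfolding rot eXZ e2 by simp
  have "X'\<^sup>2 \<le> X\<^sup>2 + Y\<^sup>2" using rot zero_le_power2[of Z'] by linarith
  then have "h\<^sup>2 * X'\<^sup>2 \<le> h\<^sup>2 * (X\<^sup>2 + Y\<^sup>2)" by (intro mult_left_mono) auto
  then show "X'\<^sup>2 + Y'\<^sup>2 \<le> (X\<^sup>2 + Y\<^sup>2) - 2 * h * \<bar>X' * Z'\<bar> + h\<^sup>2 * (X\<^sup>2 + Y\<^sup>2)"
    using E by linarith
  have "2 * \<bar>X' * Z'\<bar> \<le> X'\<^sup>2 + Z'\<^sup>2"
    using sum_squares_bound[of "\<bar>X'\<bar>" "\<bar>Z'\<bar>"] by (simp add: abs_mult)
  moreover have "0 \<le> h" using e by linarith
  ultimately have "h * (2 * \<bar>X' * Z'\<bar>) \<le> h * (X\<^sup>2 + Y\<^sup>2)"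
    unfolding rot by (intro mult_left_mono)
  moreover have "0 \<le> h\<^sup>2 * X'\<^sup>2" by simp
  ultimately show "(1 - h) * (X\<^sup>2 + Y\<^sup>2) \<le> X'\<^sup>2 + Y'\<^sup>2"
    using E unfolding left_diff_distrib mult_1 by linarith
qed

text \<open>
  The product \<open>X Y\<close> vanishes on the coordinate axes, and the product of the rotated coordinates on the
  axes rotated back. For \<open>c s \<noteq> 0\<close> the two pairs of axes meet only in the origin. In double angles:
  the rotated product is \<open>c s (X\<^sup>2 - Y\<^sup>2) + (c\<^sup>2 - s\<^sup>2) X Y\<close>, and \<open>X\<^sup>2 - Y\<^sup>2\<close> and \<open>2 X Y\<close> are the legs of
  a right triangle with hypotenuse \<open>X\<^sup>2 + Y\<^sup>2\<close>.
\<close>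

lemma consecutive_products_lower_bound:
  fixes c s :: real
  assumes cs: "c\<^sup>2 + s\<^sup>2 = 1"
  shows "\<bar>c * s\<bar> / 2 * (X\<^sup>2 + Y\<^sup>2) \<le> \<bar>X * Y\<bar> + \<bar>(c * X - s * Y) * (s * X + c * Y)\<bar>"
proof -
  define Q where "Q = (c * X - s * Y) * (s * X + c * Y)"
  have Q: "Q = c * s * (X\<^sup>2 - Y\<^sup>2) + (c\<^sup>2 - s\<^sup>2) * (X * Y)"
    unfolding Q_def by (simp add: power2_eq_square algebra_simps)
  have "\<bar>c\<^sup>2 - s\<^sup>2\<bar> \<le> 1" using cs zero_le_power2[of c] zero_le_power2[of s] by linarith
  then have "\<bar>(c\<^sup>2 - s\<^sup>2) * (X * Y)\<bar> \<le> \<bar>X * Y\<bar>"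
    unfolding abs_mult[of "c\<^sup>2 - s\<^sup>2"] by (intro mult_left_le_one_le) auto
  then have 1: "\<bar>c * s\<bar> * \<bar>X\<^sup>2 - Y\<^sup>2\<bar> \<le> \<bar>Q\<bar> + \<bar>X * Y\<bar>"
    unfolding abs_mult[of "c * s" "X\<^sup>2 - Y\<^sup>2", symmetric] using Q by linarith
  have "2 * \<bar>c * s\<bar> \<le> 1"
    using sum_squares_bound[of "\<bar>c\<bar>" "\<bar>s\<bar>"] cs by (simp add: abs_mult)
  then have 2: "(2 * \<bar>c * s\<bar>) * \<bar>X * Y\<bar> \<le> \<bar>X * Y\<bar>"
    by (intro mult_left_le_one_le) auto
  have "X\<^sup>2 + Y\<^sup>2 \<le> \<bar>X\<^sup>2 - Y\<^sup>2\<bar> + 2 * \<bar>X * Y\<bar>"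
  proof (rule power2_le_imp_le)
    have "(X\<^sup>2 + Y\<^sup>2)\<^sup>2 = \<bar>X\<^sup>2 - Y\<^sup>2\<bar>\<^sup>2 + (2 * \<bar>X * Y\<bar>)\<^sup>2"
      by (simp add: power_mult_distrib) (simp add: power2_eq_square algebra_simps)
    also have "\<dots> \<le> (\<bar>X\<^sup>2 - Y\<^sup>2\<bar> + 2 * \<bar>X * Y\<bar>)\<^sup>2"
      unfolding power2_sum by simp
    finally show "(X\<^sup>2 + Y\<^sup>2)\<^sup>2 \<le> (\<bar>X\<^sup>2 - Y\<^sup>2\<bar> + 2 * \<bar>X * Y\<bar>)\<^sup>2" .
  qed simp
  then have "\<bar>c * s\<bar> * (X\<^sup>2 + Y\<^sup>2) \<le> \<bar>c * s\<bar> * (\<bar>X\<^sup>2 - Y\<^sup>2\<bar> + 2 * \<bar>X * Y\<bar>)"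
    by (intro mult_left_mono) auto
  then have "\<bar>c * s\<bar> * (X\<^sup>2 + Y\<^sup>2) \<le> \<bar>Q\<bar> + 2 * \<bar>X * Y\<bar>"
    using 1 2 by (simp add: algebra_simps)
  then show ?thesis unfolding Q_def[symmetric] using abs_ge_zero[of Q]
    by (simp only: times_divide_eq_left)
qed

text \<open>
  The first-order gains of the two kicks are \<open>2 h \<bar>X\<^sub>1 Z\<^sub>1\<bar>\<close> and \<open>2 h \<bar>X\<^sub>2 Z\<^sub>2\<bar>\<close>. Replacing \<open>Z\<^sub>1\<close> by
  \<open>Y\<^sub>1\<close> costs only another factor \<open>h\<close>, and then the bound for consecutive products applies at the
  intermediate point. All second-order errors together stay below half of the gain
  \<open>2 \<delta> h\<close> as long as \<open>8 h \<le> \<delta>\<close>.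
\<close>

lemma two_kicks_contract:
  fixes c s :: real
  defines "\<delta> \<equiv> \<bar>c * s\<bar> / 2"
  assumes cs: "c\<^sup>2 + s\<^sup>2 = 1" and h: "8 * h \<le> \<delta>"
    and X1: "X\<^sub>1 = c * X\<^sub>0 - s * Y\<^sub>0" and Z1: "Z\<^sub>1 = s * X\<^sub>0 + c * Y\<^sub>0" and Y1: "Y\<^sub>1 = Z\<^sub>1 + e\<^sub>1 * X\<^sub>1"
    and e1: "\<bar>e\<^sub>1\<bar> = h" "e\<^sub>1 * (X\<^sub>1 * Z\<^sub>1) \<le> 0"
    and X2: "X\<^sub>2 = c * X\<^sub>1 - s * Y\<^sub>1" and Z2: "Z\<^sub>2 = s * X\<^sub>1 + c * Y\<^sub>1" and Y2: "Y\<^sub>2 = Z\<^sub>2 + e\<^sub>2 * X\<^sub>2"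
    and e2: "\<bar>e\<^sub>2\<bar> = h" "e\<^sub>2 * (X\<^sub>2 * Z\<^sub>2) \<le> 0"
  shows "X\<^sub>2\<^sup>2 + Y\<^sub>2\<^sup>2 \<le> (1 - \<delta> * h) * (X\<^sub>0\<^sup>2 + Y\<^sub>0\<^sup>2)"
proof -
  define F0 F1 where "F0 = X\<^sub>0\<^sup>2 + Y\<^sub>0\<^sup>2" and "F1 = X\<^sub>1\<^sup>2 + Y\<^sub>1\<^sup>2"
  note k1 = kicked_energy[OF cs X1 Z1 Y1 e1, folded F0_def F1_def]
  note k2 = kicked_energy(1)[OF cs X2 Z2 Y2 e2, folded F1_def]
  have h0: "0 \<le> h" using e1(1) by linarith
  have F0: "0 \<le> F0" and F1: "0 \<le> F1" unfolding F0_def F1_def by simp_all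
  have d1: "\<delta> \<le> 1"
    using sum_squares_bound[of "\<bar>c\<bar>" "\<bar>s\<bar>"] cs unfolding \<delta>_def by (simp add: abs_mult)
  have h1: "h \<le> 1" using h d1 h0 by linarith
  have "\<bar>X\<^sub>1 * Y\<^sub>1\<bar> \<le> \<bar>X\<^sub>1 * Z\<^sub>1\<bar> + h * F1"
  proof -
    have "X\<^sub>1 * Y\<^sub>1 = X\<^sub>1 * Z\<^sub>1 + e\<^sub>1 * X\<^sub>1\<^sup>2" unfolding Y1 by (simp add: power2_eq_square algebra_simps)
    moreover have "\<bar>e\<^sub>1 * X\<^sub>1\<^sup>2\<bar> = h * X\<^sub>1\<^sup>2" using e1 by (simp add: abs_mult)
    moreover have "h * X\<^sub>1\<^sup>2 \<le> h * F1" unfolding F1_def using h0 by (intro mult_left_mono) auto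
    ultimately show ?thesis by linarith
  qed
  moreover have "\<delta> * F1 \<le> \<bar>X\<^sub>1 * Y\<^sub>1\<bar> + \<bar>X\<^sub>2 * Z\<^sub>2\<bar>"
    using consecutive_products_lower_bound[OF cs, of X\<^sub>1 Y\<^sub>1] unfolding \<delta>_def F1_def X2 Z2 .
  ultimately have "(\<delta> - h) * F1 \<le> \<bar>X\<^sub>1 * Z\<^sub>1\<bar> + \<bar>X\<^sub>2 * Z\<^sub>2\<bar>" by (simp add: algebra_simps)
  moreover have "(\<delta> - h) * ((1 - h) * F0) \<le> (\<delta> - h) * F1"
    using h h0 k1(2) by (intro mult_left_mono) auto
  ultimately have "(\<delta> - h) * ((1 - h) * F0) \<le> \<bar>X\<^sub>1 * Z\<^sub>1\<bar> + \<bar>X\<^sub>2 * Z\<^sub>2\<bar>" by linarith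
  then have P: "(2 * h) * ((\<delta> - h) * ((1 - h) * F0)) \<le> (2 * h) * (\<bar>X\<^sub>1 * Z\<^sub>1\<bar> + \<bar>X\<^sub>2 * Z\<^sub>2\<bar>)"
    using h0 by (intro mult_left_mono) auto
  have "h\<^sup>2 \<le> 1" using h0 h1 by (simp add: power_le_one)
  then have "h\<^sup>2 * F0 \<le> F0" using F0 by (simp add: mult_left_le_one_le)
  moreover have "0 \<le> 2 * h * \<bar>X\<^sub>1 * Z\<^sub>1\<bar>" using h0 by simp
  ultimately have "F1 \<le> 2 * F0" using k1(1) by linarith
  then have "h\<^sup>2 * F1 \<le> h\<^sup>2 * (2 * F0)" by (intro mult_left_mono) auto
  then have main: "X\<^sub>2\<^sup>2 + Y\<^sub>2\<^sup>2 \<le> F0 - (2 * h) * ((\<delta> - h) * ((1 - h) * F0)) + 3 * h\<^sup>2 * F0"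
    using k1(1) k2 P by (simp add: algebra_simps)
  have "1 - 2 * h * (\<delta> - h) * (1 - h) + 3 * h\<^sup>2 \<le> 1 - \<delta> * h"
  proof -
    have "1 - 2 * h * (\<delta> - h) * (1 - h) + 3 * h\<^sup>2 =
        1 - 2 * (\<delta> * h) + (5 + 2 * \<delta> - 2 * h) * h\<^sup>2"
      by (simp add: power2_eq_square algebra_simps)
    moreover have "(5 + 2 * \<delta> - 2 * h) * h\<^sup>2 \<le> 8 * h\<^sup>2"
      using d1 h0 by (intro mult_right_mono) auto
    moreover have "8 * h\<^sup>2 \<le> \<delta> * h"
      using mult_right_mono[OF h h0] by (simp add: power2_eq_square)
    ultimately show ?thesis by linarith
  qed
  then have "(1 - 2 * h * (\<delta> - h) * (1 - h) + 3 * h\<^sup>2) * F0 \<le> (1 - \<delta> * h) * F0"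
    using F0 by (intro mult_right_mono) auto
  then show ?thesis using main unfolding F0_def[symmetric] by (simp add: algebra_simps)
qed

text \<open>
  The kick sizes are constant on the pairs of steps \<open>2 j \<rightarrow> 2 j + 1 \<rightarrow> 2 j + 2\<close>, so each pair contracts
  the energy by \<open>1 - 2 / m\<close> with \<open>m = j + N\<close>. Since \<open>1 - 2 / m \<le> ((m - 1) / m)\<^sup>2\<close>, the product of
  the energy with \<open>(m - 1)\<^sup>2\<close> does not increase. The shift \<open>N\<close> makes already the first kicks
  small enough.
\<close>

lemma kicked_rotation_decay:
  fixes c s :: real and X Y Z e :: "nat \<Rightarrow> real" and N :: nat
  defines "\<delta> \<equiv> \<bar>c * s\<bar> / 2"
  assumes cs: "c\<^sup>2 + s\<^sup>2 = 1" and cs0: "c * s \<noteq> 0"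
    and N: "2 \<le> N" "16 / \<delta>\<^sup>2 \<le> real N"
    and X: "\<And>k. X (Suc k) = c * X k - s * Y k"
    and Z: "\<And>k. Z (Suc k) = s * X k + c * Y k"
    and Y: "\<And>k. Y (Suc k) = Z (Suc k) + e (Suc k) * X (Suc k)"
    and e: "\<And>k. \<bar>e (Suc k)\<bar> = 2 / \<delta> / real (k div 2 + N)"
    and sgn: "\<And>k. e (Suc k) * (X (Suc k) * Z (Suc k)) \<le> 0"
  obtains K where "\<And>k. (X k)\<^sup>2 + (Y k)\<^sup>2 \<le> K / (real (Suc k))\<^sup>2"
proof -
  define F where "F k = (X k)\<^sup>2 + (Y k)\<^sup>2" for k
  define h where "h j = 2 / \<delta> / real (j + N)" for j :: nat
  have F0: "0 \<le> F k" for k unfolding F_def by simp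
  have d: "0 < \<delta>" unfolding \<delta>_def using cs0 by simp
  have d1: "\<delta> \<le> 1"
    using sum_squares_bound[of "\<bar>c\<bar>" "\<bar>s\<bar>"] cs unfolding \<delta>_def by (simp add: abs_mult)
  have h8: "8 * h j \<le> \<delta>" for j
  proof -
    have "16 / \<delta>\<^sup>2 \<le> real (j + N)" using N(2) by simp
    then have "16 / \<delta> \<le> real (j + N) * \<delta>" using d by (simp add: field_simps power2_eq_square)
    moreover have "0 < real (j + N)" using N(1) by simp
    ultimately have "16 / \<delta> / real (j + N) \<le> \<delta>" by (simp only: pos_divide_le_eq mult.commute)
    then show ?thesis by (simp add: h_def)
  qed
  have dh: "\<delta> * h j = 2 / real (j + N)" for j using d by (simp add: h_def)
  have F2: "F (2 * Suc j) \<le> (1 - \<delta> * h j) * F (2 * j)" for j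
  proof -
    have "\<bar>e (Suc (2 * j))\<bar> = h j" "\<bar>e (Suc (Suc (2 * j)))\<bar> = h j"
      using e[of "2 * j"] e[of "Suc (2 * j)"] unfolding h_def by simp_all
    from two_kicks_contract[OF cs h8[unfolded \<delta>_def] X Z Y this(1) sgn X Z Y this(2) sgn]
    show ?thesis unfolding F_def \<delta>_def by simp
  qed
  have D: "F (2 * j) * (real (j + N) - 1)\<^sup>2 \<le> F 0 * (real N - 1)\<^sup>2" for j
  proof (induction j)
    case (Suc j)
    define m where "m = real (j + N)"
    have m: "2 \<le> m" using N(1) by (simp add: m_def)
    have "F (2 * Suc j) * m\<^sup>2 \<le> (1 - 2 / m) * F (2 * j) * m\<^sup>2"
      using F2[of j] unfolding dh m_def by (intro mult_right_mono) auto
    also have "\<dots> = ((1 - 2 / m) * m\<^sup>2) * F (2 * j)" by simp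
    also have "(1 - 2 / m) * m\<^sup>2 = m\<^sup>2 - 2 * m"
      using m by (simp add: field_simps power2_eq_square)
    also have "(m\<^sup>2 - 2 * m) * F (2 * j) \<le> (m - 1)\<^sup>2 * F (2 * j)"
      using F0 by (intro mult_right_mono) (auto simp: power2_eq_square algebra_simps)
    also have "\<dots> \<le> F 0 * (real N - 1)\<^sup>2" using Suc by (simp add: m_def mult.commute)
    finally show ?case by (simp add: m_def)
  qed simp
  have E: "F (2 * j) \<le> F 0 * (real N - 1)\<^sup>2 / (real (Suc j))\<^sup>2" for j
  proof -
    have "(real (Suc j))\<^sup>2 \<le> (real (j + N) - 1)\<^sup>2"
      using N(1) by (intro power_mono) auto
    then have "F (2 * j) * (real (Suc j))\<^sup>2 \<le> F (2 * j) * (real (j + N) - 1)\<^sup>2"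
      using F0 by (intro mult_left_mono) auto
    then have "F (2 * j) * (real (Suc j))\<^sup>2 \<le> F 0 * (real N - 1)\<^sup>2" using D[of j] by linarith
    then show ?thesis by (simp add: field_simps)
  qed
  have O: "F (Suc (2 * j)) \<le> 2 * F (2 * j)" for j
  proof -
    have "\<bar>e (Suc (2 * j))\<bar> = h j" using e[of "2 * j"] unfolding h_def by simp
    from kicked_energy(1)[OF cs X Z Y this sgn]
    have *: "F (Suc (2 * j)) \<le> F (2 * j) - 2 * h j * \<bar>X (Suc (2 * j)) * Z (Suc (2 * j))\<bar>
        + (h j)\<^sup>2 * F (2 * j)" unfolding F_def .
    have "0 \<le> h j" using d by (simp add: h_def)
    moreover have "h j \<le> 1" using h8[of j] d1 \<open>0 \<le> h j\<close> by linarith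
    ultimately have "(h j)\<^sup>2 * F (2 * j) \<le> F (2 * j)"
      using F0 by (intro mult_left_le_one_le) (auto simp: power_le_one)
    moreover have "0 \<le> 2 * h j * \<bar>X (Suc (2 * j)) * Z (Suc (2 * j))\<bar>" using \<open>0 \<le> h j\<close> by simp
    ultimately show ?thesis using * by linarith
  qed
  define C where "C = 2 * (F 0 * (real N - 1)\<^sup>2)"
  have C: "0 \<le> C" using F0 by (simp add: C_def)
  have B: "F k \<le> C / (real (Suc (k div 2)))\<^sup>2" for k
  proof -
    have "F k \<le> 2 * F (2 * (k div 2))"
    proof (cases "even k")
      case True then show ?thesis using F0[of k] by simp
    next
      case False
      then have "k = Suc (2 * (k div 2))" by simp
      then show ?thesis using O[of "k div 2"] by metis
    qed
    also have "\<dots> \<le> 2 * (F 0 * (real N - 1)\<^sup>2 / (real (Suc (k div 2)))\<^sup>2)"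
      using E[of "k div 2"] by linarith
    finally show ?thesis by (simp add: C_def)
  qed
  show thesis
  proof (rule that[of "4 * C"])
    fix k
    have "Suc k \<le> 2 * Suc (k div 2)" by presburger
    then have "real (Suc k) \<le> real (2 * Suc (k div 2))" by (simp only: of_nat_le_iff)
    then have "real (Suc k) \<le> 2 * real (Suc (k div 2))" by simp
    then have "(real (Suc k))\<^sup>2 \<le> (2 * real (Suc (k div 2)))\<^sup>2" by (intro power_mono) auto
    then have "(real (Suc k))\<^sup>2 \<le> 4 * (real (Suc (k div 2)))\<^sup>2"
      by (simp add: power_mult_distrib del: of_nat_Suc)
    then have "C * (real (Suc k))\<^sup>2 \<le> C * (4 * (real (Suc (k div 2)))\<^sup>2)"
      using C by (intro mult_left_mono)
    then have "C / (real (Suc (k div 2)))\<^sup>2 \<le> 4 * C / (real (Suc k))\<^sup>2"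
      by (simp add: pos_divide_le_eq pos_le_divide_eq mult_ac del: of_nat_Suc)
    with B[of k] show "(X k)\<^sup>2 + (Y k)\<^sup>2 \<le> 4 * C / (real (Suc k))\<^sup>2" unfolding F_def by linarith
  qed
qed

section \<open>Coordinates in which an elliptic matrix is a rotation\<close>

text \<open>
  An elliptic matrix \<open>M\<close> of determinant \<open>1\<close> leaves the definite quadratic form \<open>v \<mapsto> det (v, M v)\<close>
  invariant. Completing the square in that form gives, up to a constant, the sum of the squares of
  \<open>2 s x\<close> and \<open>(m\<^sub>2\<^sub>2 - m\<^sub>1\<^sub>1) x - 2 m\<^sub>1\<^sub>2 y\<close>, and in these coordinates \<open>M\<close> is the rotation with cosine
  \<open>tr M / 2\<close>. Taking a multiple of \<open>x\<close> as the first coordinate is essential: a change of the potential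
  alters \<open>y\<close> by a multiple of \<open>x\<close>, which then remains an axis-parallel shear.
\<close>

lemma elliptic_matrix_rotation:
  fixes m11 m12 m21 m22 x y :: real
  defines "c \<equiv> (m11 + m22) / 2"
  defines "s \<equiv> sqrt (1 - c\<^sup>2)"
  assumes det: "m11 * m22 - m12 * m21 = 1" and tr: "\<bar>m11 + m22\<bar> < 2"
  shows "c\<^sup>2 + s\<^sup>2 = 1" and "s > 0" and "m12 \<noteq> 0"
    and "2 * s * (m11 * x + m12 * y) = c * (2 * s * x) - s * ((m22 - m11) * x - 2 * m12 * y)"
    and "(m22 - m11) * (m11 * x + m12 * y) - 2 * m12 * (m21 * x + m22 * y) =
      s * (2 * s * x) + c * ((m22 - m11) * x - 2 * m12 * y)"
proof -
  have "\<bar>c\<bar> < 1" using tr by (simp add: c_def)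
  then have c1: "c\<^sup>2 < 1" by (simp add: abs_square_less_1)
  then have s2: "s\<^sup>2 = 1 - c\<^sup>2" by (simp add: s_def)
  show "c\<^sup>2 + s\<^sup>2 = 1" "s > 0" using c1 s2 by (simp_all add: s_def)
  show "m12 \<noteq> 0"
  proof
    assume "m12 = 0"
    then have "m11 * m22 = 1" using det by simp
    then have "c\<^sup>2 = 1 + ((m11 - m22) / 2)\<^sup>2" unfolding c_def
      by (simp add: power2_eq_square field_simps)
    then show False using c1 zero_le_power2[of "(m11 - m22) / 2"] by linarith
  qed
  show "2 * s * (m11 * x + m12 * y) = c * (2 * s * x) - s * ((m22 - m11) * x - 2 * m12 * y)"
    unfolding c_def by (simp add: field_simps)
  have "s * (2 * s * x) = 2 * s\<^sup>2 * x" by (simp add: power2_eq_square)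
  also have "\<dots> = 2 * (m11 * m22 - m12 * m21 - c\<^sup>2) * x" unfolding s2 det ..
  finally show "(m22 - m11) * (m11 * x + m12 * y) - 2 * m12 * (m21 * x + m22 * y) =
      s * (2 * s * x) + c * ((m22 - m11) * x - 2 * m12 * y)"
    unfolding c_def by (simp add: field_simps power2_eq_square)
qed

text \<open>Read contrapositively, this turns \<open>\<theta> \<noteq> \<pi> / 2\<close> into \<open>cos \<theta> \<noteq> 0\<close>.\<close>

lemma quasi_momentum_trace_0:
  assumes J: "periodic_jacobi T a b" and tr: "trace (monodromy T a b lam) = 0"
  shows "quasi_momentum T a b lam = pi / 2"
proof -
  have l: "lam \<in> sigma_ell T a b" using tr by (simp add: sigma_ell_def)
  have "complex_eigenvalues (monodromy T a b lam) = {z. z\<^sup>2 + 1 = 0}"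
    by (simp add: complex_eigenvalues_2 det_monodromy[OF J] tr)
  also have "\<dots> = {cis (pi / 2), cis (- (pi / 2))}"
  proof -
    have "z\<^sup>2 + 1 = (z - \<i>) * (z + \<i>)" for z by (simp add: power2_eq_square algebra_simps)
    moreover have "cis (- (pi / 2)) = - \<i>" by (simp add: complex_eq_iff)
    ultimately show ?thesis by (auto simp: eq_neg_iff_add_eq_0)
  qed
  finally have "0 < pi / 2 \<and> pi / 2 < pi \<and>
      complex_eigenvalues (monodromy T a b lam) = {cis (pi / 2), cis (- (pi / 2))}"
    using pi_gt_zero by linarith
  then show ?thesis unfolding quasi_momentum_def
    by (rule the1_equality[OF quasi_momentum_unique[OF J l]])
qed

section \<open>Potentials chosen by feedback\<close>

text \<open>
  The value \<open>u (n + 2)\<close> that the unperturbed equation at site \<open>n + 1\<close> prescribes after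
  \<open>u n = x\<close> and \<open>u (n + 1) = y\<close>. At site \<open>1\<close> the coefficient \<open>a T\<close> takes the place of \<open>a 0\<close>, as in the
  transfer matrices; this is harmless for solutions with \<open>u 0 = 0\<close>.
\<close>

definition free_step ::
  "nat \<Rightarrow> (nat \<Rightarrow> real) \<Rightarrow> (nat \<Rightarrow> real) \<Rightarrow> real \<Rightarrow> nat \<Rightarrow> real \<Rightarrow> real \<Rightarrow> real" where
  "free_step T a b lam n x y =
     ((lam - b (Suc n)) * y - (if n = 0 then a T else a n) * x) / a (Suc n)"

text \<open>
  The potential at a site may depend on the solution there and on the free continuation
  beyond it, because it only influences later values of the solution. Both are produced
  by one recursion on the pairs \<open>(u n, u (n + 1))\<close>.
\<close>

lemma feedback_solution:
  fixes G :: "nat \<Rightarrow> real \<Rightarrow> real \<Rightarrow> real"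
  obtains u q :: "nat \<Rightarrow> real" where "u 0 = 0" "u (Suc 0) = 1" "q 0 = 0"
    "\<And>n. q (Suc n) = G (Suc n) (u (Suc n)) (free_step T a b lam n (u n) (u (Suc n)))"
    "\<And>n. u (Suc (Suc n)) =
       free_step T a b lam n (u n) (u (Suc n)) - q (Suc n) * u (Suc n) / a (Suc n)"
proof -
  define f where "f n p = (let z = free_step T a b lam n (fst p) (snd p) in
    (snd p, z - G (Suc n) (snd p) z * snd p / a (Suc n)))" for n and p :: "real \<times> real"
  define st where "st = rec_nat (0, 1) f"
  define u where "u n = fst (st n)" for n
  define q where "q n = (case n of 0 \<Rightarrow> 0 | Suc m \<Rightarrow>
    G (Suc m) (u (Suc m)) (free_step T a b lam m (u m) (u (Suc m))))" for n
  have st: "st 0 = (0, 1)" "st (Suc n) = f n (st n)" for n by (simp_all add: st_def)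
  have snd_st: "snd (st n) = u (Suc n)" for n by (simp add: u_def st f_def Let_def)
  show thesis
  proof (rule that[of u q])
    show "u 0 = 0" "u (Suc 0) = 1" "q 0 = 0" by (simp_all add: u_def st f_def Let_def q_def)
    show q: "q (Suc n) = G (Suc n) (u (Suc n)) (free_step T a b lam n (u n) (u (Suc n)))" for n
      by (simp add: q_def)
    show "u (Suc (Suc n)) =
       free_step T a b lam n (u n) (u (Suc n)) - q (Suc n) * u (Suc n) / a (Suc n)" for n
    proof -
      have "u (Suc (Suc n)) = snd (f n (st n))" by (metis snd_st st(2))
      then show ?thesis unfolding q by (simp add: f_def Let_def snd_st u_def[symmetric])
    qed
  qed
qed

lemma feedback_solution_eigenvector:
  assumes J: "periodic_jacobi T a b" and u0: "u 0 = 0"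
    and u: "\<And>n. u (Suc (Suc n)) =
       free_step T a b lam n (u n) (u (Suc n)) - q (Suc n) * u (Suc n) / a (Suc n)"
  shows "(\<lambda>n. jacobi_op a b u n + diagonal_op q u n) = (\<lambda>n. lam * u n)"
proof
  fix n
  show "jacobi_op a b u n + diagonal_op q u n = lam * u n"
  proof (cases n)
    case 0 then show ?thesis by (simp add: jacobi_op_def diagonal_op_def u0)
  next
    case (Suc m)
    have "a (Suc m) > 0" using J by (simp add: periodic_jacobi_def)
    then have *: "a (Suc m) * u (Suc (Suc m)) =
        (lam - b (Suc m)) * u (Suc m) - (if m = 0 then a T else a m) * u m - q (Suc m) * u (Suc m)"
      unfolding u free_step_def by (simp add: field_simps)
    show ?thesis
    proof (cases "m = 0")
      case True
      then show ?thesis using * Suc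
        by (simp add: jacobi_op_def diagonal_op_def u0 algebra_simps numeral_2_eq_2)
    next
      case False
      then show ?thesis using * Suc by (simp add: jacobi_op_def diagonal_op_def algebra_simps)
    qed
  qed
qed

lemma free_step_period:
  assumes J: "periodic_jacobi T a b" and i: "i < T"
  shows "free_step T a b lam (k * T + i) x y = free_step T a b lam i x y"
proof -
  have per: "a (k * T + Suc j) = a (Suc j)" "b (k * T + Suc j) = b (Suc j)" for k j
  proof (induction k)
    case (Suc k)
    have "a (k * T + Suc j + T) = a (k * T + Suc j)" "b (k * T + Suc j + T) = b (k * T + Suc j)"
      using J unfolding periodic_jacobi_def by auto
    with Suc show "a (Suc k * T + Suc j) = a (Suc j)" "b (Suc k * T + Suc j) = b (Suc j)"
      by (simp_all add: add_ac)
  qed simp_all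
  have "(if k * T + i = 0 then a T else a (k * T + i)) = (if i = 0 then a T else a i)"
  proof (cases i)
    case 0
    show ?thesis
    proof (cases k)
      case (Suc l)
      have "a (l * T + Suc (T - 1)) = a (Suc (T - 1))" by (rule per)
      then show ?thesis using i Suc 0 by (simp add: add.commute)
    qed (simp add: 0)
  next
    case (Suc j) then show ?thesis using per(1)[of k j] by simp
  qed
  then show ?thesis using per[of k i] unfolding free_step_def by simp
qed

lemma transfer_product_Suc_vector:
  "transfer_product T a b lam (Suc i) *v v =
     vector [(transfer_product T a b lam i *v v) $ 2,
       free_step T a b lam i ((transfer_product T a b lam i *v v) $ 1)
         ((transfer_product T a b lam i *v v) $ 2)]"
proof -
  have "transfer_matrix T a b lam (Suc i) *v w =
      vector [w $ 2, free_step T a b lam i (w $ 1) (w $ 2)]" for w :: "real^2"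
    by (simp add: vec_eq_iff forall_2 matrix_vector_mult_def sum_2 transfer_matrix_def
        free_step_def diff_divide_distrib left_diff_distrib)
  then show ?thesis by (simp add: matrix_vector_mul_assoc[symmetric])
qed

lemma solution_within_period:
  fixes u :: "nat \<Rightarrow> real"
  assumes J: "periodic_jacobi T a b"
    and q: "\<And>n. \<not> T dvd n \<Longrightarrow> q n = 0"
    and u: "\<And>n. u (Suc (Suc n)) =
       free_step T a b lam n (u n) (u (Suc n)) - q (Suc n) * u (Suc n) / a (Suc n)"
    and i: "i < T"
  shows "transfer_product T a b lam i *v vector [u (k * T), u (Suc (k * T))] =
     vector [u (k * T + i), u (Suc (k * T + i))]"
  using i
proof (induction i)
  case (Suc i)
  have "\<not> T dvd Suc (k * T + i)"
  proof
    assume "T dvd Suc (k * T + i)"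
    then have "T dvd k * T + Suc i" by simp
    then have "T dvd Suc i" by (metis dvd_add_right_iff dvd_triv_right)
    then show False using Suc.prems by (auto dest: dvd_imp_le)
  qed
  then have "u (Suc (Suc (k * T + i))) =
      free_step T a b lam i (u (k * T + i)) (u (Suc (k * T + i)))"
    using u[of "k * T + i"] q free_step_period[OF J, of i] Suc.prems by simp
  then show ?case using Suc unfolding transfer_product_Suc_vector by simp
qed simp

text \<open>
  The second component is still the free continuation at the site \<open>(k + 1) T\<close>; the potential there
  replaces it by the value of \<open>u\<close>.
\<close>

lemma solution_across_period:
  fixes u :: "nat \<Rightarrow> real"
  assumes J: "periodic_jacobi T a b"
    and q: "\<And>n. \<not> T dvd n \<Longrightarrow> q n = 0"
    and u: "\<And>n. u (Suc (Suc n)) =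
       free_step T a b lam n (u n) (u (Suc n)) - q (Suc n) * u (Suc n) / a (Suc n)"
  shows "monodromy T a b lam *v vector [u (k * T), u (Suc (k * T))] =
     vector [u (Suc k * T), free_step T a b lam (Suc k * T - 1) (u (Suc k * T - 1)) (u (Suc k * T))]"
proof -
  from J have "T \<ge> 1" by (simp add: periodic_jacobi_def)
  then obtain t where t: "T = Suc t" by (cases T) auto
  have "Suc k * T - 1 = k * T + t" "Suc k * T = Suc (k * T + t)" by (simp_all add: t)
  moreover have "free_step T a b lam (k * T + t) = free_step T a b lam t"
    using free_step_period[OF J, of t] t by (intro ext) simp
  moreover have "transfer_product T a b lam t *v vector [u (k * T), u (Suc (k * T))] =
     vector [u (k * T + t), u (Suc (k * T + t))]"
    by (rule solution_within_period[OF J q u]) (simp_all add: t)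
  ultimately show ?thesis unfolding monodromy_def
    by (subst (2) t) (simp only: transfer_product_Suc_vector vector_2)
qed

section \<open>Decay of the potential and of the solution\<close>

text \<open>
  Since \<open>k div 2 + N\<close> lies between \<open>(k + 1) / 2\<close> and \<open>(k + 1) N\<close>, the size of \<open>q\<close> at \<open>n = (k + 1) T\<close>
  is comparable with \<open>1 / n\<close>; these sites being infinitely many, \<open>q\<close> is not of smaller order.
\<close>

lemma sparse_potential_order:
  fixes q :: "nat \<Rightarrow> real"
  assumes T: "1 \<le> T" and N: "1 \<le> N" and A: "0 < A" and q0: "q 0 = 0"
    and sparse: "\<And>n. \<not> T dvd n \<Longrightarrow> q n = 0"
    and q: "\<And>k. \<bar>q (Suc k * T)\<bar> = A / real (k div 2 + N)"
  shows "q \<in> O(\<lambda>n. 1 / real n)" and "q \<notin> o(\<lambda>n. 1 / real n)"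
proof -
  have "\<bar>q n\<bar> \<le> (2 * A * real T) * \<bar>1 / real n\<bar>" for n
  proof (cases "T dvd n \<and> n \<noteq> 0")
    case True
    then obtain m where "n = T * m" "m \<noteq> 0" by auto
    then obtain k where n: "n = Suc k * T" by (metis mult.commute not0_implies_Suc)
    have "Suc k \<le> 2 * (k div 2 + N)" using N by presburger
    then have "real (Suc k) \<le> real (2 * (k div 2 + N))" by (simp only: of_nat_le_iff)
    then have "real (Suc k) \<le> 2 * real (k div 2 + N)" by simp
    then have "A * real (Suc k) \<le> A * (2 * real (k div 2 + N))"
      using A by (intro mult_left_mono) auto
    then have "A / real (k div 2 + N) \<le> 2 * A / real (Suc k)"
      using N by (simp add: pos_divide_le_eq pos_le_divide_eq mult_ac)
    also have "\<dots> = (2 * A * real T) * \<bar>1 / real n\<bar>"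
      using T unfolding n of_nat_mult by (simp del: of_nat_Suc)
    finally show ?thesis unfolding n q .
  next
    case False
    then have "q n = 0" using q0 sparse by (cases "n = 0") auto
    then show ?thesis using A by simp
  qed
  then show "q \<in> O(\<lambda>n. 1 / real n)" by (intro bigoI[of _ "2 * A * real T"]) simp
  show "q \<notin> o(\<lambda>n. 1 / real n)"
  proof
    assume "q \<in> o(\<lambda>n. 1 / real n)"
    moreover have "0 < A / (2 * real N)" using A N by simp
    ultimately have "eventually (\<lambda>n. norm (q n) \<le> A / (2 * real N) * norm (1 / real n)) sequentially"
      by (rule landau_o.smallD)
    then obtain k where k: "\<And>n. n \<ge> k \<Longrightarrow> norm (q n) \<le> A / (2 * real N) * norm (1 / real n)"
      unfolding eventually_sequentially by blast
    have "k \<le> Suc k * T" using T by (simp add: trans_le_add1 le_add2 add_increasing)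
    from k[OF this] have "A / real (k div 2 + N) \<le> A / (2 * real N) * (1 / real (Suc k * T))"
      unfolding real_norm_def q by simp
    also have "\<dots> = A / real (2 * N * (Suc k * T))" by simp
    finally have "real (2 * N * (Suc k * T)) \<le> real (k div 2 + N)"
      using A N T by (simp add: divide_simps split: if_splits)
    then have "2 * N * (Suc k * T) \<le> k div 2 + N" by (simp only: of_nat_le_iff)
    moreover have "2 * N * (Suc k * 1) \<le> 2 * N * (Suc k * T)"
      using T by (intro mult_le_mono) auto
    ultimately have "2 * N * Suc k \<le> k div 2 + N" by (simp only: mult_1_right)
    then have "2 * N + 2 * (N * k) \<le> k div 2 + N" by (simp add: mult_ac)
    moreover have "k \<le> N * k" using N by simp
    moreover have "k div 2 \<le> k" by simp
    ultimately show False using N by linarith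
  qed
qed

lemma summable_blockwise:
  fixes u :: "nat \<Rightarrow> real"
  assumes T: "1 \<le> T" and u: "\<And>k i. i < T \<Longrightarrow> (u (k * T + i))\<^sup>2 \<le> B / (real (Suc k))\<^sup>2"
  shows "summable (\<lambda>n. (u n)\<^sup>2)"
proof (rule summable_comparison_test')
  have "summable (\<lambda>n. inverse ((real n)\<^sup>2))"
    using inverse_power_summable[of 2, where ?'a = real] by simp
  then have "summable (\<lambda>n. inverse ((real (Suc n))\<^sup>2))" by (subst summable_Suc_iff)
  then show "summable (\<lambda>n. (B * (real T)\<^sup>2) * inverse ((real (Suc n))\<^sup>2))" by (rule summable_mult)
  fix n :: nat
  have "(u 0)\<^sup>2 \<le> B" using u[of 0 0] T by simp
  then have "0 \<le> B" using zero_le_power2[of "u 0"] by linarith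
  have "n = n div T * T + n mod T" by simp
  moreover have iT: "n mod T < T" using T by simp
  ultimately have "Suc n \<le> Suc (n div T) * T" by (metis Suc_leI add.commute add_less_cancel_left mult_Suc)
  then have "real (Suc n) \<le> real (Suc (n div T)) * real T" by (metis of_nat_le_iff of_nat_mult)
  then have "(real (Suc n))\<^sup>2 \<le> (real (Suc (n div T)) * real T)\<^sup>2" by (intro power_mono) auto
  then have "B * (real (Suc n))\<^sup>2 \<le> B * ((real (Suc (n div T)))\<^sup>2 * (real T)\<^sup>2)"
    using \<open>0 \<le> B\<close> unfolding power_mult_distrib by (intro mult_left_mono)
  then have "B / (real (Suc (n div T)))\<^sup>2 \<le> (B * (real T)\<^sup>2) * inverse ((real (Suc n))\<^sup>2)"
    by (simp only: divide_inverse[symmetric]) (simp add: pos_divide_le_eq pos_le_divide_eq mult_ac)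
  moreover have "(u n)\<^sup>2 \<le> B / (real (Suc (n div T)))\<^sup>2" using u[OF iT, of "n div T"] by simp
  ultimately show "norm ((u n)\<^sup>2) \<le> (B * (real T)\<^sup>2) * inverse ((real (Suc n))\<^sup>2)" by simp
qed

theorem theorem2p8:
  fixes T :: nat and a b :: "nat \<Rightarrow> real" and lam :: real
  assumes "periodic_jacobi T a b"
    and "lam \<in> sigma_ell T a b"
    and "quasi_momentum T a b lam \<noteq> pi / 2"
  shows "\<exists>q u :: nat \<Rightarrow> real.
           q \<in> O(\<lambda>n. 1 / real n) \<and> q \<notin> o(\<lambda>n. 1 / real n) \<and>
           u \<in> ell2 \<and> u \<noteq> (\<lambda>n. 0) \<and>
           (\<lambda>n. jacobi_op a b u n + diagonal_op q u n) = (\<lambda>n. lam * u n)"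
proof -
  note J = assms(1)
  have T: "1 \<le> T" using J by (simp add: periodic_jacobi_def)
  have aT: "0 < a T" using J T by (simp add: periodic_jacobi_def)
  have aper: "a (Suc k * T) = a T" for k
  proof (induction k)
    case (Suc k)
    have "1 \<le> Suc k * T" using T by simp
    then have "a (Suc k * T + T) = a (Suc k * T)" using J unfolding periodic_jacobi_def by blast
    with Suc show ?case by (simp add: add_ac)
  qed simp
  define M where "M = monodromy T a b lam"
  define m11 m12 m21 m22 where "m11 = M $ 1 $ 1" and "m12 = M $ 1 $ 2"
    and "m21 = M $ 2 $ 1" and "m22 = M $ 2 $ 2"
  note m_defs = m11_def m12_def m21_def m22_def
  have det: "m11 * m22 - m12 * m21 = 1"
    using det_monodromy[OF J, of lam] unfolding M_def[symmetric] det_2 m_defs .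
  have trM: "trace M = m11 + m22" by (simp add: trace_def sum_2 m_defs)
  have tr: "\<bar>m11 + m22\<bar> < 2" using assms(2) trM by (simp add: sigma_ell_def M_def)
  have tr0: "m11 + m22 \<noteq> 0" using quasi_momentum_trace_0[OF J] assms(3) trM M_def by metis
  define c where "c = (m11 + m22) / 2"
  define s where "s = sqrt (1 - c\<^sup>2)"
  note rot = elliptic_matrix_rotation[OF det tr, folded c_def, folded s_def]
  have cs0: "c * s \<noteq> 0" using tr0 rot(2) by (simp add: c_def)
  define \<delta> where "\<delta> = \<bar>c * s\<bar> / 2"
  have d: "0 < \<delta>" using cs0 by (simp add: \<delta>_def)
  define N where "N = max 2 (nat \<lceil>16 / \<delta>\<^sup>2\<rceil>)"
  have N: "2 \<le> N" "16 / \<delta>\<^sup>2 \<le> real N" unfolding N_def by linarith+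
  define \<eta> where "\<eta> x y = (m22 - m11) * x - 2 * m12 * y" for x y
  \<comment> \<open>The size of the kick is \<open>2 / (\<delta> m)\<close> in rotated coordinates; the factor \<open>a T s / m\<^sub>1\<^sub>2\<close> translates it
    into a value of the potential. The site \<open>n = (k + 1) T\<close> ends step number \<open>k\<close>, which belongs to
    the pair \<open>k div 2\<close>.\<close>
  define G where "G n x z = (if T dvd n then
      (if x * \<eta> x z * (m12 / (a T * s)) > 0 then - 1 else 1) *
      (\<bar>a T * s / m12\<bar> * (2 / \<delta>) / real ((n div T - 1) div 2 + N)) else 0)" for n x z
  obtain u q where u0: "u 0 = 0" and u1: "u (Suc 0) = 1" and q0: "q 0 = 0"
    and qG: "\<And>n. q (Suc n) = G (Suc n) (u (Suc n)) (free_step T a b lam n (u n) (u (Suc n)))"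
    and u: "\<And>n. u (Suc (Suc n)) =
       free_step T a b lam n (u n) (u (Suc n)) - q (Suc n) * u (Suc n) / a (Suc n)"
    using feedback_solution[of G T a b lam] by metis
  have sparse: "q n = 0" if "\<not> T dvd n" for n
    using that qG by (cases n) (simp_all add: G_def)
  \<comment> \<open>For \<open>k \<ge> 1\<close>, what \<open>u (k T + 1)\<close> would be without the potential at the site \<open>k T\<close>.\<close>
  define w where "w k = free_step T a b lam (k * T - 1) (u (k * T - 1)) (u (k * T))" for k
  define A where "A = \<bar>a T * s / m12\<bar> * (2 / \<delta>)"
  have A: "0 < A" using aT rot(2,3) d by (simp add: A_def)
  have SkT: "Suc (Suc k * T - 1) = Suc k * T" for k using T by simp
  have qk: "q (Suc k * T) = (if u (Suc k * T) * \<eta> (u (Suc k * T)) (w (Suc k)) * (m12 / (a T * s)) > 0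
      then - 1 else 1) * (A / real (k div 2 + N))" for k
  proof -
    have "Suc k * T div T - 1 = k" using T by simp
    moreover have "T dvd Suc k * T" by simp
    ultimately show ?thesis
      using qG[of "Suc k * T - 1"] unfolding SkT G_def w_def[symmetric] A_def by (simp del: mult_Suc)
  qed
  have absq: "\<bar>q (Suc k * T)\<bar> = A / real (k div 2 + N)" for k
    unfolding qk using A by (simp add: abs_mult)
  define X where "X k = 2 * s * u (k * T)" for k
  define Y where "Y k = \<eta> (u (k * T)) (u (Suc (k * T)))" for k
  define Z where "Z k = \<eta> (u (k * T)) (w k)" for k
  define e where "e k = m12 / (a T * s) * q (k * T)" for k
  have M: "u (Suc k * T) = m11 * u (k * T) + m12 * u (Suc (k * T))"
       "w (Suc k) = m21 * u (k * T) + m22 * u (Suc (k * T))" for k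
  proof -
    have "M *v vector [u (k * T), u (Suc (k * T))] = vector [u (Suc k * T), w (Suc k)]"
      unfolding M_def w_def by (rule solution_across_period[OF J sparse u])
    then show "u (Suc k * T) = m11 * u (k * T) + m12 * u (Suc (k * T))"
       "w (Suc k) = m21 * u (k * T) + m22 * u (Suc (k * T))"
      by (simp_all add: vec_eq_iff forall_2 matrix_vector_mult_def sum_2 m_defs del: mult_Suc)
  qed
  have XS: "X (Suc k) = c * X k - s * Y k" for k
    unfolding X_def Y_def \<eta>_def M(1) by (rule rot(4))
  have ZS: "Z (Suc k) = s * X k + c * Y k" for k
    unfolding X_def Y_def Z_def \<eta>_def M by (rule rot(5))
  have YS: "Y (Suc k) = Z (Suc k) + e (Suc k) * X (Suc k)" for k
  proof -
    have "u (Suc (Suc k * T)) = w (Suc k) - q (Suc k * T) * u (Suc k * T) / a T"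
      using u[of "Suc k * T - 1"] unfolding SkT aper w_def .
    moreover have "e (Suc k) * X (Suc k) = 2 * m12 * (q (Suc k * T) * u (Suc k * T) / a T)"
      using rot(2) unfolding X_def e_def by (simp del: mult_Suc)
    ultimately show ?thesis unfolding Y_def Z_def \<eta>_def by (simp add: right_diff_distrib del: mult_Suc)
  qed
  have eS: "\<bar>e (Suc k)\<bar> = 2 / \<delta> / real (k div 2 + N)" for k
  proof -
    have "\<bar>e (Suc k)\<bar> = \<bar>m12 / (a T * s)\<bar> * (A / real (k div 2 + N))"
      unfolding e_def abs_mult absq ..
    also have "\<dots> = (\<bar>m12 / (a T * s)\<bar> * \<bar>a T * s / m12\<bar>) * (2 / \<delta> / real (k div 2 + N))"
      by (simp add: A_def)
    also have "\<bar>m12 / (a T * s)\<bar> * \<bar>a T * s / m12\<bar> = 1"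
      using rot(2,3) aT by (simp flip: abs_mult)
    finally show ?thesis by simp
  qed
  have sgn: "e (Suc k) * (X (Suc k) * Z (Suc k)) \<le> 0" for k
  proof -
    define p where "p = u (Suc k * T) * \<eta> (u (Suc k * T)) (w (Suc k)) * (m12 / (a T * s))"
    define g where "g = 2 * s * (A / real (k div 2 + N))"
    have "0 \<le> g" using rot(2) A by (simp add: g_def)
    have "e (Suc k) * (X (Suc k) * Z (Suc k)) = (if p > 0 then - 1 else 1) * p * g"
      unfolding e_def X_def Z_def qk p_def[symmetric] by (simp add: p_def g_def del: mult_Suc)
    also have "\<dots> = - \<bar>p\<bar> * g" by simp
    finally show ?thesis using \<open>0 \<le> g\<close> by simp
  qed
  obtain K where K: "\<And>k. (X k)\<^sup>2 + (Y k)\<^sup>2 \<le> K / (real (Suc k))\<^sup>2"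
    using kicked_rotation_decay[OF rot(1) cs0 N(1) N(2)[unfolded \<delta>_def] XS ZS YS eS[unfolded \<delta>_def] sgn]
    by blast
  \<comment> \<open>Inside a period the solution is a fixed linear combination of \<open>X\<close> and \<open>Y\<close> at its start, with
    coefficients found by inverting the change of coordinates.\<close>
  define P where "P i = transfer_product T a b lam i" for i
  define \<beta> where "\<beta> i = - P i $ 1 $ 2 / (2 * m12)" for i
  define \<alpha> where "\<alpha> i = (P i $ 1 $ 1 - \<beta> i * (m22 - m11)) / (2 * s)" for i
  have within: "u (k * T + i) = \<alpha> i * X k + \<beta> i * Y k" if "i < T" for k i
  proof -
    have "P i *v vector [u (k * T), u (Suc (k * T))] = vector [u (k * T + i), u (Suc (k * T + i))]"
      unfolding P_def by (rule solution_within_period[OF J sparse u that])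
    then have "u (k * T + i) = P i $ 1 $ 1 * u (k * T) + P i $ 1 $ 2 * u (Suc (k * T))"
      by (simp add: vec_eq_iff forall_2 matrix_vector_mult_def sum_2)
    also have "\<dots> = \<alpha> i * X k + \<beta> i * Y k"
      using rot(2,3) unfolding X_def Y_def \<eta>_def \<alpha>_def \<beta>_def by (simp add: field_simps)
    finally show ?thesis .
  qed
  define S where "S = (\<Sum>i<T. (\<alpha> i)\<^sup>2 + (\<beta> i)\<^sup>2)"
  have "(u (k * T + i))\<^sup>2 \<le> S * K / (real (Suc k))\<^sup>2" if i: "i < T" for k i
  proof -
    \<comment> \<open>Lagrange's identity, used as the Cauchy--Schwarz inequality.\<close>
    have "((\<alpha> i)\<^sup>2 + (\<beta> i)\<^sup>2) * ((X k)\<^sup>2 + (Y k)\<^sup>2) =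
        (\<alpha> i * X k + \<beta> i * Y k)\<^sup>2 + (\<alpha> i * Y k - \<beta> i * X k)\<^sup>2"
      by (simp add: power2_eq_square algebra_simps)
    then have "(u (k * T + i))\<^sup>2 \<le> ((\<alpha> i)\<^sup>2 + (\<beta> i)\<^sup>2) * ((X k)\<^sup>2 + (Y k)\<^sup>2)"
      unfolding within[OF i] by simp
    also have "\<dots> \<le> S * (K / (real (Suc k))\<^sup>2)"
    proof (rule mult_mono)
      show "(\<alpha> i)\<^sup>2 + (\<beta> i)\<^sup>2 \<le> S" unfolding S_def using i by (intro member_le_sum) auto
      show "0 \<le> S" unfolding S_def by (intro sum_nonneg) auto
    qed (use K in auto)
    finally show ?thesis by simp
  qed
  from summable_blockwise[OF T this] have "u \<in> ell2" by (simp add: ell2_def u0)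
  moreover have "u \<noteq> (\<lambda>n. 0)" using u1 by auto
  moreover have "q \<in> O(\<lambda>n. 1 / real n)" "q \<notin> o(\<lambda>n. 1 / real n)"
    using sparse_potential_order[OF T _ A q0 sparse absq] N(1) by auto
  moreover have "(\<lambda>n. jacobi_op a b u n + diagonal_op q u n) = (\<lambda>n. lam * u n)"
    by (rule feedback_solution_eigenvector[OF J u0 u])
  ultimately show ?thesis by blast
qed

end
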